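(* Let $(V,\star,\alpha)$ be a unital hom-associative algebra over a field $K$. If any of the following conditions is satisfied, then $(V,\star)$ is associative: \begin{enumerate} \item $\operatorname{codim}(\operatorname{Im}(\alpha))\leq 1$; \item $\operatorname{codim}(\operatorname{Im}(\alpha))\leq 2$ and $(V,\star)$ is commutative; \item $\operatorname{codim}(\operatorname{Im}(\alpha))\leq 2$ and $\alpha$ is injective on $\operatorname{Im}(\alpha)$. \end{enumerate}
   Context: A hom-associative algebra $(V,\star,\alpha)$ over a field $K$ is a $K$-vector space $V$ (possibly infinite-dimensional) with a $K$-bilinear, not necessarily associative, product $\star: V\times V\to V$ and a $K$-linear map $\alpha:V\to V$ (the twisting map, not assumed multiplicative) such that $\alpha(x)\star(y\star z)=(x\star y)\star\alpha(z)$ for all $x,y,z\in V$. It is unital if there is an element $1\in V$ with $1\star x=x\star 1=x$ for all $x\in V$. Here $\operatorname{Im}(\alpha)$ is the image of $\alpha$, and $\operatorname{codim}(\operatorname{Im}(\alpha))=\dim_K (V/\operatorname{Im}(\alpha))$ is its codimension as a $K$-vector subspace of $V$. *)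

theory Defs
  imports Complex_Main "HOL-Library.Set_Algebras" "HOL-Library.Extended_Nat"
begin

text \<open>
  The quotient space \<open>V / W\<close> by a subspace \<open>W\<close>, with the cosets \<open>x +o W\<close> as elements. Addition of
  cosets is the elementwise sum of sets, and the zero vector is \<open>W\<close> itself. In the scalar
  multiplication, the summand \<open>W\<close> only matters for \<open>c = 0\<close>, where the image of a coset under
  \<open>scale c\<close> is \<open>{0}\<close> rather than \<open>W\<close>.
\<close>

definition quotient_space :: "'v::ab_group_add set \<Rightarrow> 'v set set" where
  "quotient_space W = range (\<lambda>x. x +o W)"

definition quotient_scale ::
    "('k::field \<Rightarrow> 'v::ab_group_add \<Rightarrow> 'v) \<Rightarrow> 'v set \<Rightarrow> 'k \<Rightarrow> 'v set \<Rightarrow> 'v set" where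
  "quotient_scale scale W c A = scale c ` A + W"

definition quotient_subspace ::
    "('k::field \<Rightarrow> 'v::ab_group_add \<Rightarrow> 'v) \<Rightarrow> 'v set \<Rightarrow> 'v set set \<Rightarrow> bool" where
  "quotient_subspace scale W S \<longleftrightarrow> S \<subseteq> quotient_space W \<and> W \<in> S \<and>
     (\<forall>A\<in>S. \<forall>B\<in>S. A + B \<in> S) \<and> (\<forall>c. \<forall>A\<in>S. quotient_scale scale W c A \<in> S)"

definition quotient_span ::
    "('k::field \<Rightarrow> 'v::ab_group_add \<Rightarrow> 'v) \<Rightarrow> 'v set \<Rightarrow> 'v set set \<Rightarrow> 'v set set" where
  "quotient_span scale W X = quotient_subspace scale W hull X"

definition quotient_basis ::
    "('k::field \<Rightarrow> 'v::ab_group_add \<Rightarrow> 'v) \<Rightarrow> 'v set \<Rightarrow> 'v set set \<Rightarrow> bool" where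
  "quotient_basis scale W X \<longleftrightarrow> X \<subseteq> quotient_space W \<and>
     (\<forall>A\<in>X. A \<notin> quotient_span scale W (X - {A})) \<and>
     quotient_span scale W X = quotient_space W"

text \<open>
  The codimension is the dimension of the quotient space, with value \<open>\<infinity>\<close> if the quotient is not
  finite-dimensional (unlike \<open>vector_space.dim\<close>, which is then \<open>0\<close>).
\<close>

definition codim :: "('k::field \<Rightarrow> 'v::ab_group_add \<Rightarrow> 'v) \<Rightarrow> 'v set \<Rightarrow> enat" where
  "codim scale W = (if \<exists>X. finite X \<and> quotient_basis scale W X
     then enat (card (SOME X. finite X \<and> quotient_basis scale W X)) else \<infinity>)"

locale hom_associative_algebra = vector_space scale
  for scale :: "'k::field \<Rightarrow> 'v::ab_group_add \<Rightarrow> 'v" +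
  fixes prod :: "'v \<Rightarrow> 'v \<Rightarrow> 'v" (infixl "\<star>" 70)
    and \<alpha> :: "'v \<Rightarrow> 'v"
  assumes linear_prod_right: "\<And>x. Vector_Spaces.linear scale scale (\<lambda>y. x \<star> y)"
    and linear_prod_left: "\<And>y. Vector_Spaces.linear scale scale (\<lambda>x. x \<star> y)"
    and linear_twist: "Vector_Spaces.linear scale scale \<alpha>"
    and hom_associative: "\<And>x y z. \<alpha> x \<star> (y \<star> z) = (x \<star> y) \<star> \<alpha> z"

locale unital_hom_associative_algebra = hom_associative_algebra +
  assumes unital: "\<exists>e. \<forall>x. e \<star> x = x \<and> x \<star> e = x"

end

theory Submission
  imports Defs
begin

text \<open>
  Write \<open>e\<close> for the unit. Setting one of the three variables of hom-associativity to \<open>e\<close> shows that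
  \<open>\<alpha>\<close> lies in the centroid: \<open>\<alpha> (x \<star> y) = \<alpha> x \<star> y = x \<star> \<alpha> y\<close>. Hence the hom-associative law says
  exactly that \<open>\<alpha>\<close> kills all associators (\<open>twist_associator\<close>). Pulling \<open>\<alpha>\<close> out of an associator,
  one sees that associators with an entry in the image \<open>W\<close> of \<open>\<alpha>\<close> vanish; those with an entry \<open>e\<close>
  vanish as well. The associator is trilinear, so it is determined by its values on vectors that
  span \<open>V\<close> modulo \<open>W\<close>.

  If \<open>codim W \<le> 2\<close>, the exchange lemma provides an element \<open>v\<close> such that \<open>e\<close> and \<open>v\<close> span \<open>V\<close> modulo
  \<open>W\<close>; if \<open>codim W \<le> 1\<close>, one may take \<open>v = e\<close>. All that remains is
  \<open>(v \<star> v) \<star> v = v \<star> (v \<star> v)\<close> (\<open>assoc_if_cube_assoc\<close>). This is clear for \<open>v = e\<close> and for commutative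
  products. In the last case, write \<open>v \<star> v = c e + d v + \<alpha> w\<close>. Only the last summand may fail to
  commute with \<open>v\<close>, so the associator of \<open>v, v, v\<close> is \<open>\<alpha> (w \<star> v - v \<star> w)\<close>. It lies in \<open>W\<close> and in the
  kernel of \<open>\<alpha>\<close>, which have only \<open>0\<close> in common when \<open>\<alpha>\<close> is injective on \<open>W\<close>.
\<close>

section \<open>Spanning modulo a subspace of finite codimension\<close>

context vector_space
begin

lemma quotient_scale_coset:
  assumes W: "subspace W"
  shows "quotient_scale scale W c (x +o W) = scale c x +o W"
proof
  show "quotient_scale scale W c (x +o W) \<subseteq> scale c x +o W"
    unfolding quotient_scale_def elt_set_plus_def set_plus_def
    using subspace_add[OF W] subspace_scale[OF W]
    by (auto simp: scale_right_distrib add.assoc)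
  show "scale c x +o W \<subseteq> quotient_scale scale W c (x +o W)"
  proof
    fix y assume "y \<in> scale c x +o W"
    then obtain w where "w \<in> W" "y = scale c (x + 0) + w"
      by (auto simp: elt_set_plus_def)
    then show "y \<in> quotient_scale scale W c (x +o W)"
      unfolding quotient_scale_def elt_set_plus_def set_plus_def
      using subspace_0[OF W] by blast
  qed
qed

lemma coset_plus_coset:
  assumes W: "subspace W"
  shows "(x +o W) + (y +o W) = (x + y) +o W"
proof -
  have "W + W = W"
  proof
    show "W + W \<subseteq> W"
      using subspace_add[OF W] by (auto simp: set_plus_def)
    show "W \<subseteq> W + W"
      using subspace_0[OF W] by (force simp: set_plus_def)
  qed
  then show ?thesis
    by (simp add: set_plus_rearrange)
qed

lemma quotient_subspace_cosets:
  assumes W: "subspace W" and T: "subspace T"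
  shows "quotient_subspace scale W ((\<lambda>x. x +o W) ` T)"
  unfolding quotient_subspace_def
proof (intro conjI ballI allI)
  show "(\<lambda>x. x +o W) ` T \<subseteq> quotient_space W"
    by (auto simp: quotient_space_def)
  have "W = 0 +o W"
    by simp
  then show "W \<in> (\<lambda>x. x +o W) ` T"
    using subspace_0[OF T] by blast
next
  fix A B assume "A \<in> (\<lambda>x. x +o W) ` T" "B \<in> (\<lambda>x. x +o W) ` T"
  then show "A + B \<in> (\<lambda>x. x +o W) ` T"
    using coset_plus_coset[OF W] subspace_add[OF T] by auto
next
  fix c A assume "A \<in> (\<lambda>x. x +o W) ` T"
  then show "quotient_scale scale W c A \<in> (\<lambda>x. x +o W) ` T"
    using quotient_scale_coset[OF W] subspace_scale[OF T] by auto
qed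

text \<open>
  Representatives of a basis of the quotient work: the cosets of the vectors in the span of the
  representatives and \<open>W\<close> form a subspace of the quotient that contains the basis.
\<close>

lemma codim_le_imp_spanning:
  assumes W: "subspace W" and codim: "codim scale W \<le> enat n"
  obtains U where "finite U" "card U \<le> n" "span (U \<union> W) = UNIV"
proof -
  define P where "P X \<longleftrightarrow> finite X \<and> quotient_basis scale W X" for X
  have ex: "\<exists>X. P X"
    using codim by (auto simp: codim_def P_def split: if_splits)
  define X where "X = (SOME X. P X)"
  have "P X"
    unfolding X_def using ex by (rule someI_ex)
  then have fin: "finite X" and basis: "quotient_basis scale W X"
    by (auto simp: P_def)
  have card: "card X \<le> n"
    using codim ex by (simp add: codim_def X_def P_def)
  have "\<forall>A\<in>X. \<exists>x. A = x +o W"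
    using basis by (auto simp: quotient_basis_def quotient_space_def)
  then obtain r where r: "A = r A +o W" if "A \<in> X" for A
    by metis
  define T where "T = span (r ` X \<union> W)"
  have T: "subspace T" and "r ` X \<subseteq> T" and WT: "W \<subseteq> T"
    using span_superset[of "r ` X \<union> W"] by (auto simp: T_def)
  have "A \<in> (\<lambda>x. x +o W) ` T" if "A \<in> X" for A
    using r[OF that] by (rule image_eqI) (use \<open>r ` X \<subseteq> T\<close> that in auto)
  then have "X \<subseteq> (\<lambda>x. x +o W) ` T"
    by (rule subsetI)
  then have "quotient_span scale W X \<subseteq> (\<lambda>x. x +o W) ` T"
    unfolding quotient_span_def
    using quotient_subspace_cosets[OF W T] by (rule hull_minimal)
  then have cosets: "quotient_space W \<subseteq> (\<lambda>x. x +o W) ` T"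
    using basis by (simp add: quotient_basis_def)
  have "x \<in> T" for x
  proof -
    obtain t where t: "t \<in> T" "x +o W = t +o W"
      using cosets by (auto simp: quotient_space_def)
    have "x + 0 \<in> t +o W"
      unfolding t(2)[symmetric] using subspace_0[OF W] by (rule set_plus_intro2)
    then obtain w where "w \<in> W" "x = t + w"
      by (auto simp: elt_set_plus_def)
    then show "x \<in> T"
      using t(1) WT subspace_add[OF T] by auto
  qed
  then have "span (r ` X \<union> W) = UNIV"
    by (auto simp: T_def)
  moreover have "card (r ` X) \<le> n"
    using card card_image_le[OF fin] le_trans by blast
  ultimately show thesis
    using that fin by blast
qed

text \<open>The Steinitz exchange step, relative to a fixed set \<open>W\<close>.\<close>

lemma exchange_modulo:
  assumes "finite U" "e \<in> span (U \<union> W)" "e \<notin> span W"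
  shows "\<exists>u\<in>U. u \<in> span (insert e (U - {u} \<union> W))"
  using assms
proof (induction U rule: finite_induct)
  case empty
  then show ?case by simp
next
  case (insert u F)
  show ?case
  proof (cases "e \<in> span (F \<union> W)")
    case True
    then obtain u' where u': "u' \<in> F" "u' \<in> span (insert e (F - {u'} \<union> W))"
      using insert by blast
    then have "u' \<in> span (insert e (insert u F - {u'} \<union> W))"
      using span_mono[of "insert e (F - {u'} \<union> W)" "insert e (insert u F - {u'} \<union> W)"]
      by blast
    then show ?thesis
      using u'(1) by blast
  next
    case False
    then have "u \<in> span (insert e (F \<union> W))"
      using in_span_insert[of e u "F \<union> W"] insert.prems by simp
    moreover have "insert u F - {u} = F"
      using insert.hyps by auto
    ultimately show ?thesis
      by simp
  qed
qed

lemma codim_le_Suc_imp_spanning: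
  assumes W: "subspace W" and codim: "codim scale W \<le> enat (Suc n)" and e: "e \<notin> W"
  obtains U where "finite U" "card U \<le> n" "span (insert e (U \<union> W)) = UNIV"
proof -
  obtain U where U: "finite U" "card U \<le> Suc n" "span (U \<union> W) = UNIV"
    using codim_le_imp_spanning[OF W codim] .
  have "e \<notin> span W"
    using e W by (metis span_eq_iff)
  then obtain u where u: "u \<in> U" "u \<in> span (insert e (U - {u} \<union> W))"
    using exchange_modulo[OF U(1)] U(3) by blast
  have "U \<union> W \<subseteq> span (insert e (U - {u} \<union> W))"
    using u span_superset[of "insert e (U - {u} \<union> W)"] by blast
  then have "span (U \<union> W) \<subseteq> span (insert e (U - {u} \<union> W))"
    using span_minimal subspace_span by blast
  then have "span (insert e (U - {u} \<union> W)) = UNIV"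
    using U(3) by blast
  moreover have "card (U - {u}) \<le> n"
    using U u by (simp add: card_Diff_singleton)
  ultimately show thesis
    using that U(1) by blast
qed

end

section \<open>Associators in unital hom-associative algebras\<close>

context hom_associative_algebra
begin

lemma prod_add_right: "x \<star> (y + z) = x \<star> y + x \<star> z"
  by (rule module_hom.add[OF linear_prod_right[unfolded linear_iff_module_hom]])

lemma prod_add_left: "(x + y) \<star> z = x \<star> z + y \<star> z"
  by (rule module_hom.add[OF linear_prod_left[unfolded linear_iff_module_hom]])

lemma prod_scale_right: "x \<star> scale c y = scale c (x \<star> y)"
  by (rule module_hom.scale[OF linear_prod_right[unfolded linear_iff_module_hom]])

lemma prod_scale_left: "scale c x \<star> y = scale c (x \<star> y)"
  by (rule module_hom.scale[OF linear_prod_left[unfolded linear_iff_module_hom]])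

lemma prod_zero_right: "x \<star> 0 = 0"
  by (rule module_hom.zero[OF linear_prod_right[unfolded linear_iff_module_hom]])

lemma prod_zero_left: "0 \<star> x = 0"
  by (rule module_hom.zero[OF linear_prod_left[unfolded linear_iff_module_hom]])

lemmas prod_simps = prod_add_right prod_add_left prod_scale_right prod_scale_left
  prod_zero_right prod_zero_left

lemma subspace_range_twist: "subspace (range \<alpha>)"
  using module_hom.subspace_image[OF linear_twist[unfolded linear_iff_module_hom] subspace_UNIV] .

text \<open>Trilinearity of the associator, applied to one argument after the other.\<close>

lemma assoc_if_assoc_on_spanning:
  assumes span: "span G = UNIV"
    and G: "\<And>x y z. x \<in> G \<Longrightarrow> y \<in> G \<Longrightarrow> z \<in> G \<Longrightarrow> (x \<star> y) \<star> z = x \<star> (y \<star> z)"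
  shows "(x \<star> y) \<star> z = x \<star> (y \<star> z)"
proof -
  have induct: "P v" if "subspace {v. P v}" "\<And>v. v \<in> G \<Longrightarrow> P v" for P v
    using span_induct[of v G P] that span by simp
  have 1: "(x \<star> y) \<star> z = x \<star> (y \<star> z)" if "x \<in> G" "y \<in> G" for x y z
    by (rule induct) (use G that in \<open>simp_all add: subspace_def prod_simps\<close>)
  have 2: "(x \<star> y) \<star> z = x \<star> (y \<star> z)" if "x \<in> G" for x y z
    by (rule induct) (use 1 that in \<open>simp_all add: subspace_def prod_simps\<close>)
  show ?thesis
    by (rule induct[of _ x]) (use 2 in \<open>simp_all add: subspace_def prod_simps\<close>)
qed

end

locale hom_associative_algebra_with_unit = hom_associative_algebra +
  fixes e
  assumes unit_left: "e \<star> x = x" and unit_right: "x \<star> e = x"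
begin

text \<open>
  Hom-associativity with middle entry \<open>e\<close> gives \<open>\<alpha> x \<star> z = x \<star> \<alpha> z\<close>, and with first entry \<open>e\<close> it
  gives \<open>\<alpha> e \<star> (y \<star> z) = y \<star> \<alpha> z\<close>. By the former, \<open>\<alpha>\<close> is left multiplication by \<open>\<alpha> e\<close>, so the
  latter reads \<open>\<alpha> (y \<star> z) = y \<star> \<alpha> z\<close>.
\<close>

lemma twist_prod_right: "\<alpha> (x \<star> y) = x \<star> \<alpha> y"
  by (metis hom_associative unit_left unit_right)

lemma twist_prod_left: "\<alpha> (x \<star> y) = \<alpha> x \<star> y"
  by (metis hom_associative twist_prod_right unit_right)

lemma twist_associator: "\<alpha> ((x \<star> y) \<star> z) = \<alpha> (x \<star> (y \<star> z))"
  by (metis hom_associative twist_prod_left twist_prod_right)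

lemma assoc_twist_entry:
  assumes "x \<in> range \<alpha> \<or> y \<in> range \<alpha> \<or> z \<in> range \<alpha>"
  shows "(x \<star> y) \<star> z = x \<star> (y \<star> z)"
  using assms twist_associator
  by (auto simp flip: twist_prod_left twist_prod_right)

lemma assoc_if_cube_assoc:
  assumes span: "span (insert e (insert v (range \<alpha>))) = UNIV"
    and cube: "(v \<star> v) \<star> v = v \<star> (v \<star> v)"
  shows "(x \<star> y) \<star> z = x \<star> (y \<star> z)"
proof (rule assoc_if_assoc_on_spanning[OF span])
  fix x y z
  assume "x \<in> insert e (insert v (range \<alpha>))" "y \<in> insert e (insert v (range \<alpha>))"
    "z \<in> insert e (insert v (range \<alpha>))"
  then show "(x \<star> y) \<star> z = x \<star> (y \<star> z)"
    using cube assoc_twist_entry by (auto simp: unit_left unit_right)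
qed

text \<open>The image of \<open>\<alpha>\<close> is an ideal, so it is everything once it contains the unit.\<close>

lemma range_twist_eq_UNIV:
  assumes "e \<in> range \<alpha>"
  shows "range \<alpha> = UNIV"
  using assms by (metis UNIV_eq_I imageE rangeI twist_prod_left unit_left)

lemma codim_le_one_spanning:
  assumes "codim scale (range \<alpha>) \<le> 1"
  shows "span (insert e (insert e (range \<alpha>))) = UNIV"
proof (cases "e \<in> range \<alpha>")
  case True
  then show ?thesis
    using range_twist_eq_UNIV by simp
next
  case False
  then obtain U where "finite U" "card U \<le> 0" "span (insert e (U \<union> range \<alpha>)) = UNIV"
    using codim_le_Suc_imp_spanning[OF subspace_range_twist, of 0] assms
    by (auto simp: one_enat_def)
  then show ?thesis by simp
qed

lemma codim_le_two_spanning: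
  assumes "codim scale (range \<alpha>) \<le> 2"
  obtains v where "span (insert e (insert v (range \<alpha>))) = UNIV"
proof (cases "e \<in> range \<alpha>")
  case True
  then show thesis
    using that range_twist_eq_UNIV by simp
next
  case False
  then obtain U where U: "finite U" "card U \<le> 1" "span (insert e (U \<union> range \<alpha>)) = UNIV"
    using codim_le_Suc_imp_spanning[OF subspace_range_twist, of 1] assms
    by (auto simp: numeral_eq_enat numeral_2_eq_2)
  then obtain v where "U \<subseteq> {v}"
    by (metis card_le_Suc0_iff_eq One_nat_def empty_subsetI insertCI subsetI)
  then have "span (insert e (U \<union> range \<alpha>)) \<subseteq> span (insert e (insert v (range \<alpha>)))"
    by (intro span_mono) auto
  then show thesis
    using that U(3) by blast
qed

text \<open>
  Up to a combination of \<open>e\<close> and \<open>v\<close>, which commutes with \<open>v\<close>, the square of \<open>v\<close> is some \<open>\<alpha> w\<close>. The associator of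
  \<open>v, v, v\<close> is therefore the commutator of \<open>\<alpha> w\<close> and \<open>v\<close>, which lies in the image of \<open>\<alpha>\<close>; being an
  associator, it also lies in the kernel.
\<close>

lemma cube_assoc_if_inj_twist:
  assumes span: "span (insert e (insert v (range \<alpha>))) = UNIV"
    and inj: "inj_on \<alpha> (range \<alpha>)"
  shows "(v \<star> v) \<star> v = v \<star> (v \<star> v)"
proof -
  obtain c where "v \<star> v - scale c e \<in> span (insert v (range \<alpha>))"
    using span span_breakdown_eq[of "v \<star> v" e] by blast
  then obtain d where "v \<star> v - scale c e - scale d v \<in> span (range \<alpha>)"
    using span_breakdown_eq by blast
  then obtain w where "v \<star> v - scale c e - scale d v = \<alpha> w"
    using span_eq_iff[THEN iffD2, OF subspace_range_twist] by auto
  then have vv: "v \<star> v = scale c e + scale d v + \<alpha> w"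
    by (simp add: algebra_simps)
  have left: "(v \<star> v) \<star> v = scale c v + scale d (v \<star> v) + \<alpha> (w \<star> v)"
    using arg_cong[OF vv, of "\<lambda>x. x \<star> v"]
    by (simp add: prod_simps unit_left twist_prod_left)
  have right: "v \<star> (v \<star> v) = scale c v + scale d (v \<star> v) + \<alpha> (v \<star> w)"
    using arg_cong[OF vv, of "\<lambda>x. v \<star> x"]
    by (simp add: prod_simps unit_right twist_prod_right)
  have add: "\<alpha> (a + b) = \<alpha> a + \<alpha> b" for a b
    by (rule module_hom.add[OF linear_twist[unfolded linear_iff_module_hom]])
  have "\<alpha> (\<alpha> (w \<star> v)) = \<alpha> (\<alpha> (v \<star> w))"
    using twist_associator[of v v v] by (simp add: left right add)
  then have "\<alpha> (w \<star> v) = \<alpha> (v \<star> w)"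
    using inj by (simp add: inj_on_eq_iff)
  then show ?thesis
    by (simp add: left right)
qed

end

theorem proposition1p2:
  fixes scale :: "'k::field \<Rightarrow> 'v::ab_group_add \<Rightarrow> 'v"
    and prod :: "'v \<Rightarrow> 'v \<Rightarrow> 'v" (infixl "\<star>" 70)
    and \<alpha> :: "'v \<Rightarrow> 'v"
  assumes "unital_hom_associative_algebra scale prod \<alpha>"
    and "codim scale (range \<alpha>) \<le> 1
      \<or> codim scale (range \<alpha>) \<le> 2 \<and> (\<forall>x y. x \<star> y = y \<star> x)
      \<or> codim scale (range \<alpha>) \<le> 2 \<and> inj_on \<alpha> (range \<alpha>)"
  shows "\<forall>x y z. (x \<star> y) \<star> z = x \<star> (y \<star> z)"
proof -
  interpret unital_hom_associative_algebra scale prod \<alpha>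
    by (rule assms(1))
  obtain e where e: "\<forall>x. e \<star> x = x \<and> x \<star> e = x"
    using unital by blast
  interpret hom_associative_algebra_with_unit scale prod \<alpha> e
    by unfold_locales (use e in auto)
  have "\<exists>v. span (insert e (insert v (range \<alpha>))) = UNIV \<and> (v \<star> v) \<star> v = v \<star> (v \<star> v)"
    using assms(2)
  proof (elim disjE conjE)
    assume "codim scale (range \<alpha>) \<le> 1"
    then show ?thesis
      using codim_le_one_spanning unit_left by (intro exI[of _ e]) simp
  next
    assume "codim scale (range \<alpha>) \<le> 2" and comm: "\<forall>x y. x \<star> y = y \<star> x"
    then show ?thesis
      using codim_le_two_spanning by metis
  next
    assume "codim scale (range \<alpha>) \<le> 2" and "inj_on \<alpha> (range \<alpha>)"
    then show ?thesis
      using codim_le_two_spanning cube_assoc_if_inj_twist by metis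
  qed
  then show ?thesis
    using assoc_if_cube_assoc by blast
qed

end
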